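(* Let $k\ge 1$ and let $A\in GL_k(\mathbf{Q})\cap M_k(\mathbf{Z})$ have an eigenvalue $\lambda\in\mathbf{C}$ such that $\lambda^l=1$ for some integer $l\ge 1$. Let $\mu$ be a probability distribution on $\mathbf{Z}^k$ whose support is not parallel to a proper subspace of $\mathbf{Q}^k$ invariant under $A$, let $\{\mathbf{B}_n\}_{n\ge 0}$ be independent random vectors in $\mathbf{Z}^k$ with common law $\mu$, and suppose $\|\mathbf{B}_n\|_\infty\in L^2$ for all $n\in\mathbf{N}$. Let $\mathbf{x}_0\in\mathbf{Z}^k$. For each modulus $p$ let $\mathbf{X}_{n+1}=A\mathbf{X}_n+\mathbf{B}_n$ (mod $p$), $\mathbf{X}_0=\mathbf{x}_0$, and let $P_n$ be the law of $\mathbf{X}_n$ on $\mathbf{Z}_p^k$. Let $B=(\mathbf{y}_1\,\dots\,\mathbf{y}_k)$ be a matrix whose columns form a basis of $\mathbf{Q}^k$ contained in $V^{d-1}$. Then there exist $\gamma\in\mathbf{R}^{+}$ and $N\in\mathbf{N}$ such that, for all $p\in\mathbf{N}$ with $p>N$ and $\gcd(\det(A),p)=\gcd(\det(B),p)=1$, and for all $n\in\mathbf{N}$, $$\|P_n-U\|\ge \frac12\exp\left(-\frac{\gamma n}{p^2}\right).$$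
   Context: $\mathbf{Z}_p^k=(\mathbf{Z}/p\mathbf{Z})^k$; $U$ is the uniform distribution on $\mathbf{Z}_p^k$; $\|P_n-U\|=\frac12\sum_{\mathbf{x}\in\mathbf{Z}_p^k}|P_n(\mathbf{x})-U(\mathbf{x})|$ is the variation distance. $d\le k$ is the degree of the minimum polynomial of $A$. The support of $\mu$ is parallel to a subspace $W\subset\mathbf{Q}^k$ if it is contained in some translate $\mathbf{v}+W$; "proper" means $W\neq\mathbf{Q}^k$ (so $W=\{\mathbf 0\}$ is allowed). Set $V=\{\mathbf{h}-\mathbf{k}:\mathbf{h},\mathbf{k}\in\operatorname{supp}\mu\}$ and $V^{d-1}=\{A^m\mathbf{x}:\mathbf{x}\in V,\ m=0,1,\dots,d-1\}$. Under the hypothesis on the support of $\mu$, $V^{d-1}$ contains a basis of $\mathbf{Q}^k$; one such basis $\{\mathbf{y}_1,\dots,\mathbf{y}_k\}$ is fixed and $B$ is the integer matrix with these columns. $\|\mathbf{B}_n\|_\infty\in L^2$ means $E[\|\mathbf{B}_n\|_\infty^2]<\infty$, with $\|\cdot\|_\infty$ the maximum norm. The matrix $A$, the law $\mu$ and the vector $\mathbf{x}_0$ do not depend on $p$. *)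

theory Defs
  imports "HOL-Probability.Probability" "HOL-Computational_Algebra.Polynomial"
begin

section \<open>Matrices over the integers, seen over larger rings\<close>

abbreviation of_int_vec :: "int ^ 'k \<Rightarrow> 'a::ring_1 ^ 'k" where
  "of_int_vec x \<equiv> (\<chi> i. of_int (x $ i))"

abbreviation of_int_matrix :: "int ^ 'k ^ 'k \<Rightarrow> 'a::ring_1 ^ 'k ^ 'k" where
  "of_int_matrix A \<equiv> map_matrix of_int A"

definition eigenvalue :: "'a::field ^ 'k ^ 'k \<Rightarrow> 'a \<Rightarrow> bool" where
  "eigenvalue A c \<longleftrightarrow> (\<exists>v. v \<noteq> 0 \<and> A *v v = c *s v)"

section \<open>The minimum polynomial of a square matrix\<close>

text \<open>The class operation \<open>^\<close> on \<open>'a ^ 'k ^ 'k\<close> would be the entrywise power, hence the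
  iterated matrix product.\<close>

definition matrix_power :: "'a::semiring_1 ^ 'k ^ 'k \<Rightarrow> nat \<Rightarrow> 'a ^ 'k ^ 'k" where
  "matrix_power A m = (((**) A) ^^ m) (mat 1)"

definition poly_matrix :: "'a::field poly \<Rightarrow> 'a ^ 'k ^ 'k \<Rightarrow> 'a ^ 'k ^ 'k" where
  "poly_matrix q A = (\<Sum>i\<le>degree q. map_matrix ((*) (coeff q i)) (matrix_power A i))"

definition is_minimum_polynomial :: "'a::field ^ 'k ^ 'k \<Rightarrow> 'a poly \<Rightarrow> bool" where
  "is_minimum_polynomial A q \<longleftrightarrow>
     lead_coeff q = 1 \<and> poly_matrix q A = 0 \<and>
     (\<forall>r. r \<noteq> 0 \<and> poly_matrix r A = 0 \<longrightarrow> degree q \<le> degree r)"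

definition minimum_polynomial :: "'a::field ^ 'k ^ 'k \<Rightarrow> 'a poly" where
  "minimum_polynomial A = (THE q. is_minimum_polynomial A q)"

lemma poly_matrix_nth:
  assumes "degree q \<le> N"
  shows "poly_matrix q A $ a $ b = (\<Sum>i\<le>N. coeff q i * matrix_power A i $ a $ b)"
proof -
  have "poly_matrix q A $ a $ b = (\<Sum>i\<le>degree q. coeff q i * matrix_power A i $ a $ b)"
    by (simp add: poly_matrix_def)
  also have "\<dots> = (\<Sum>i\<le>N. coeff q i * matrix_power A i $ a $ b)"
    using assms by (intro sum.mono_neutral_left) (auto simp: coeff_eq_0)
  finally show ?thesis .
qed

lemma poly_matrix_diff: "poly_matrix (q - r) A = poly_matrix q A - poly_matrix r A"
proof -
  define N where "N = max (degree q) (degree r)"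
  have "degree (q - r) \<le> N" "degree q \<le> N" "degree r \<le> N"
    by (auto simp: N_def degree_diff_le_max)
  then show ?thesis
    by (simp add: vec_eq_iff poly_matrix_nth[where N = N] left_diff_distrib sum_subtractf)
qed

lemma poly_matrix_smult: "poly_matrix (smult c q) A = map_matrix ((*) c) (poly_matrix q A)"
proof -
  have "degree (smult c q) \<le> degree q"
    by (rule degree_smult_le)
  then show ?thesis
    by (simp add: vec_eq_iff poly_matrix_nth[where N = "degree q"] sum_distrib_left mult.assoc)
qed

lemma annihilating_polynomial_exists:
  fixes A :: "'a::field ^ 'k ^ 'k"
  shows "\<exists>q. q \<noteq> 0 \<and> poly_matrix q A = 0"
proof -
  define f :: "nat \<Rightarrow> 'a ^ ('k \<times> 'k)" where
    "f i = (\<chi> z. matrix_power A i $ fst z $ snd z)" for i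
  define N where "N = CARD('k \<times> 'k)"
  have "\<exists>c. (\<exists>i\<le>N. c i \<noteq> 0) \<and> (\<Sum>i\<le>N. c i *s f i) = 0"
  proof (cases "inj_on f {..N}")
    case False
    then obtain i j where ij: "i \<le> N" "j \<le> N" "i \<noteq> j" "f i = f j"
      by (auto simp: inj_on_def)
    define c :: "nat \<Rightarrow> 'a" where "c m = (if m = i then 1 else if m = j then -1 else 0)" for m
    have "(\<Sum>m\<le>N. c m *s f m) = (\<Sum>m\<in>{i,j}. c m *s f m)"
      using ij by (intro sum.mono_neutral_right) (auto simp: c_def)
    also have "\<dots> = 0"
      using ij by (simp add: c_def vec_eq_iff)
    finally have "(\<Sum>m\<le>N. c m *s f m) = 0" .
    moreover have "c i \<noteq> 0" by (simp add: c_def)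
    ultimately show ?thesis using ij by blast
  next
    case True
    then have card: "card (f ` {..N}) = Suc N"
      by (simp add: card_image)
    have "vec.dependent (f ` {..N})"
    proof (rule ccontr)
      assume "\<not> vec.dependent (f ` {..N})"
      then have "card (f ` {..N}) \<le> vec.dim (UNIV :: ('a ^ ('k \<times> 'k)) set)"
        by (metis vec.independent_card_le_dim subset_UNIV)
      then show False
        using card by (simp add: N_def vec_dim_card card_cart_basis)
    qed
    then obtain u where u: "\<exists>v\<in>f ` {..N}. u v \<noteq> 0" "(\<Sum>v\<in>f ` {..N}. u v *s v) = 0"
      by (auto simp: vec.dependent_finite)
    then have "(\<Sum>i\<le>N. u (f i) *s f i) = 0"
      using True by (simp add: sum.reindex)
    then show ?thesis
      using u(1) by (intro exI[of _ "u \<circ> f"]) auto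
  qed
  then obtain c i where c: "i \<le> N" "c i \<noteq> 0" "(\<Sum>i\<le>N. c i *s f i) = 0"
    by blast
  define q where "q = (\<Sum>i\<le>N. monom (c i) i)"
  have coeff: "coeff q m = (if m \<le> N then c m else 0)" for m
    by (simp add: q_def coeff_sum)
  have deg: "degree q \<le> N"
    by (rule degree_le) (simp add: coeff)
  have "q \<noteq> 0"
    using c coeff[of i] by auto
  moreover have "poly_matrix q A $ a $ b = 0" for a b
  proof -
    have "poly_matrix q A $ a $ b = (\<Sum>i\<le>N. c i *s f i) $ (a, b)"
      by (simp add: poly_matrix_nth[OF deg] coeff f_def)
    then show ?thesis
      by (simp add: c)
  qed
  ultimately show ?thesis
    by (auto simp: vec_eq_iff)
qed

lemma ex1_minimum_polynomial: "\<exists>!q. is_minimum_polynomial A q"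
proof -
  obtain q where q: "q \<noteq> 0" "poly_matrix q A = 0"
      and least: "\<And>r. r \<noteq> 0 \<Longrightarrow> poly_matrix r A = 0 \<Longrightarrow> degree q \<le> degree r"
    using ex_has_least_nat[of "\<lambda>q. q \<noteq> 0 \<and> poly_matrix q A = 0" _ degree]
      annihilating_polynomial_exists[of A] by blast
  define m where "m = smult (inverse (lead_coeff q)) q"
  have "is_minimum_polynomial A m"
    using q least by (auto simp: is_minimum_polynomial_def m_def poly_matrix_smult vec_eq_iff)
  moreover have "r = s" if "is_minimum_polynomial A r" "is_minimum_polynomial A s" for r s
  proof (rule ccontr)
    assume "r \<noteq> s"
    have r: "lead_coeff r = 1" "poly_matrix r A = 0" and s: "lead_coeff s = 1" "poly_matrix s A = 0"
      using that by (auto simp: is_minimum_polynomial_def)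
    have deg: "degree r = degree s"
      using that unfolding is_minimum_polynomial_def
      by (metis le_antisym leading_coeff_0_iff zero_neq_one)
    have ann: "poly_matrix (r - s) A = 0" and nz: "r - s \<noteq> 0"
      using \<open>r \<noteq> s\<close> r s by (auto simp: poly_matrix_diff)
    then have "degree r \<le> degree (r - s)"
      using that by (auto simp: is_minimum_polynomial_def)
    moreover have "degree (r - s) \<le> degree r"
      by (rule degree_diff_le) (auto simp: deg)
    ultimately have "degree (r - s) = degree r"
      by simp
    then have "lead_coeff (r - s) = 0"
      using r s deg by simp
    then show False
      using nz leading_coeff_0_iff by blast
  qed
  ultimately show ?thesis by blast
qed

lemma is_minimum_polynomial_minimum_polynomial: "is_minimum_polynomial A (minimum_polynomial A)"
  unfolding minimum_polynomial_def using ex1_minimum_polynomial by (rule theI')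

section \<open>Subspaces of \<open>\<rat>\<^sup>k\<close> and the support of the increments\<close>

definition parallel_to :: "(int ^ 'k) set \<Rightarrow> (rat ^ 'k) set \<Rightarrow> bool" where
  "parallel_to S W \<longleftrightarrow> (\<exists>v. of_int_vec ` S \<subseteq> (+) v ` W)"

definition invariant_subspace :: "'a::field ^ 'k ^ 'k \<Rightarrow> ('a ^ 'k) set \<Rightarrow> bool" where
  "invariant_subspace A W \<longleftrightarrow> vec.subspace W \<and> (\<forall>w\<in>W. A *v w \<in> W)"

definition support_differences :: "(int ^ 'k) pmf \<Rightarrow> (int ^ 'k) set" where
  "support_differences \<mu> = {h - k | h k. h \<in> set_pmf \<mu> \<and> k \<in> set_pmf \<mu>}"

text \<open>The set \<open>V\<^sup>d\<^sup>-\<^sup>1\<close>, where \<open>V\<close> is the set of differences and \<open>d\<close> the degree of the minimum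
  polynomial of \<open>A\<close> over the rationals.\<close>

definition shifted_differences :: "int ^ 'k ^ 'k \<Rightarrow> (int ^ 'k) pmf \<Rightarrow> (int ^ 'k) set" where
  "shifted_differences A \<mu> =
     {matrix_power A m *v x | m x. x \<in> support_differences \<mu> \<and>
        m < degree (minimum_polynomial (of_int_matrix A :: rat ^ 'k ^ 'k))}"

definition columns_form_rat_basis :: "int ^ 'k ^ 'k \<Rightarrow> bool" where
  "columns_form_rat_basis B \<longleftrightarrow>
     vec.independent (columns (of_int_matrix B :: rat ^ 'k ^ 'k)) \<and>
     vec.span (columns (of_int_matrix B :: rat ^ 'k ^ 'k)) = UNIV"

section \<open>The affine recursion modulo \<open>p\<close>\<close>

text \<open>\<open>(\<int>/p\<int>)\<^sup>k\<close> is represented by the vectors of least non-negative residues.\<close>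

definition Zp_vectors :: "nat \<Rightarrow> (int ^ 'k) set" where
  "Zp_vectors p = {x. \<forall>i. 0 \<le> x $ i \<and> x $ i < int p}"

definition mod_vec :: "nat \<Rightarrow> int ^ 'k \<Rightarrow> int ^ 'k" where
  "mod_vec p x = (\<chi> i. x $ i mod int p)"

primrec affine_recursion ::
  "nat \<Rightarrow> int ^ 'k ^ 'k \<Rightarrow> (nat \<Rightarrow> 'w \<Rightarrow> int ^ 'k) \<Rightarrow> int ^ 'k \<Rightarrow> nat \<Rightarrow> 'w \<Rightarrow> int ^ 'k" where
  "affine_recursion p A \<B> x0 0 = (\<lambda>\<omega>. mod_vec p x0)"
| "affine_recursion p A \<B> x0 (Suc n) =
     (\<lambda>\<omega>. mod_vec p (A *v affine_recursion p A \<B> x0 n \<omega> + \<B> n \<omega>))"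

definition variation_distance_uniform :: "nat \<Rightarrow> (int ^ 'k) measure \<Rightarrow> real" where
  "variation_distance_uniform p P =
     (\<Sum>x\<in>Zp_vectors p. \<bar>measure P {x} - pmf (pmf_of_set (Zp_vectors p)) x\<bar>) / 2"

lemma Zp_vectors_eq_image:
  "Zp_vectors p = vec_lambda ` (Pi UNIV (\<lambda>_. {0..<int p}) :: ('k::finite \<Rightarrow> int) set)"
proof (intro equalityI subsetI)
  fix x :: "int ^ 'k"
  assume "x \<in> Zp_vectors p"
  then have "vec_nth x \<in> Pi UNIV (\<lambda>_. {0..<int p})"
    by (auto simp: Zp_vectors_def)
  then show "x \<in> vec_lambda ` (Pi UNIV (\<lambda>_. {0..<int p}) :: ('k \<Rightarrow> int) set)"
    by (intro image_eqI[of _ _ "vec_nth x"]) auto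
qed (auto simp: Zp_vectors_def Pi_def)

lemma finite_Zp_vectors: "finite (Zp_vectors p :: (int ^ 'k) set)"
  and card_Zp_vectors: "card (Zp_vectors p :: (int ^ 'k) set) = p ^ CARD('k)"
proof -
  have Pi: "(Pi UNIV (\<lambda>_. {0..<int p}) :: ('k \<Rightarrow> int) set) = PiE UNIV (\<lambda>_. {0..<int p})"
    by (auto simp: PiE_def)
  show "finite (Zp_vectors p :: (int ^ 'k) set)"
    unfolding Zp_vectors_eq_image Pi by (intro finite_imageI finite_PiE) auto
  have "inj_on vec_lambda (PiE UNIV (\<lambda>_. {0..<int p}) :: ('k \<Rightarrow> int) set)"
    by (rule inj_onI) (metis vec_lambda_inverse UNIV_I)
  then show "card (Zp_vectors p :: (int ^ 'k) set) = p ^ CARD('k)"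
    unfolding Zp_vectors_eq_image Pi by (simp add: card_image card_PiE)
qed

end

theory Submission
  imports Defs
begin

text \<open>The idea is to test the law of \<open>X\<^sub>n\<close> against one character of \<open>(\<int>/p\<int>)\<^sup>k\<close> that the
  recursion moves through only finitely many characters. For an integer row vector \<open>u\<close> put
  \<open>\<chi>\<^sub>u(x) = exp (2\<pi>i u x / p)\<close>. Unless \<open>p\<close> divides every entry of \<open>u\<close>, this character has
  mean zero under the uniform distribution, so the variation distance is at least half of
  \<open>\<bar>E \<chi>\<^sub>u(X\<^sub>n)\<bar>\<close> (\<open>variation_distance_ge_character\<close>).

  Since \<open>\<chi>\<^sub>u(A x + b) = \<chi>\<^bsub>uA\<^esub>(x) \<chi>\<^sub>u(b)\<close>, unrolling the recursion and using independence shows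
  that \<open>\<bar>E \<chi>\<^sub>u(X\<^sub>n)\<bar>\<close> is the product over \<open>m < n\<close> of \<open>\<bar>E \<chi>\<^bsub>uA^m\<^esub>(b)\<bar>\<close>, where \<open>b\<close> has law \<open>\<mu>\<close>
  (\<open>norm_expectation_character_affine_recursion\<close>).

  An eigenvalue that is a root of unity makes the integer matrix \<open>A^l - 1\<close> singular, so it has
  a nonzero integer row vector \<open>u\<close> in its left kernel (\<open>fixed_row_vector_exists\<close>). This \<open>u\<close>
  does not depend on \<open>p\<close>, and the vectors \<open>uA^m\<close> repeat with period \<open>l\<close>, so that their entries
  are bounded uniformly in \<open>m\<close>. Every phase in the product is therefore of the order of \<open>1/p\<close>
  times the increment, and \<open>cos t \<ge> 1 - t\<^sup>2/2\<close> together with the finite second moment bounds each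
  factor below by \<open>1 - C/p\<^sup>2\<close> with a single constant \<open>C\<close>
  (\<open>norm_character_expectation_ge\<close>). For large \<open>p\<close> this is at least \<open>exp (-2C/p\<^sup>2)\<close>, and the
  product of \<open>n\<close> such factors gives the bound.\<close>

section \<open>An integer row vector fixed by a power of the matrix\<close>

lemma matrix_power_0: "matrix_power A 0 = mat 1"
  and matrix_power_Suc: "matrix_power A (Suc m) = A ** matrix_power A m"
  by (simp_all add: matrix_power_def)

lemma matrix_power_add: "matrix_power A (m + n) = matrix_power A m ** matrix_power A n"
  by (induction m) (simp_all add: matrix_power_0 matrix_power_Suc matrix_mul_assoc)

lemma of_int_matrix_power:
  fixes A :: "int ^ 'k ^ 'k"
  shows "(of_int_matrix (matrix_power A m) :: 'a::ring_1 ^ 'k ^ 'k) =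
           matrix_power (of_int_matrix A) m"
proof (induction m)
  case 0
  show ?case
    by (simp add: matrix_power_0 vec_eq_iff mat_def)
next
  case (Suc m)
  show ?case
    unfolding matrix_power_Suc Suc[symmetric]
    by (simp add: matrix_matrix_mult_def vec_eq_iff)
qed

lemma det_of_int_matrix:
  fixes A :: "int ^ 'k ^ 'k"
  shows "det (of_int_matrix A :: 'a::comm_ring_1 ^ 'k ^ 'k) = of_int (det A)"
  by (simp add: det_def)

lemma matrix_power_eigenvector:
  fixes A :: "'a::field ^ 'k ^ 'k"
  assumes "A *v v = c *s v"
  shows "matrix_power A m *v v = c ^ m *s v"
proof (induction m)
  case (Suc m)
  have "matrix_power A (Suc m) *v v = A *v (c ^ m *s v)"
    by (simp add: matrix_power_Suc matrix_vector_mul_assoc[symmetric] Suc)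
  also have "\<dots> = c ^ m *s (c *s v)"
    by (simp add: vec.scale assms)
  finally show ?case
    by (simp add: vector_smult_assoc mult.commute)
qed (simp add: matrix_power_0)

lemma clear_denominators:
  fixes z :: "rat ^ 'k"
  shows "\<exists>(c::int) u. c \<noteq> 0 \<and> of_int_vec u = of_int c *s z"
proof -
  define d where "d i = snd (quotient_of (z $ i))" for i
  define m where "m i = fst (quotient_of (z $ i))" for i
  have d: "d i > 0" and z: "z $ i = of_int (m i) / of_int (d i)" for i
    by (auto simp: d_def m_def quotient_of_denom_pos' intro: quotient_of_div)
  define c where "c = (\<Prod>i\<in>UNIV. d i)"
  have "c \<noteq> 0"
    using d by (simp add: c_def) (metis less_irrefl)
  moreover have "of_int_vec (\<chi> i. m i * (\<Prod>j\<in>UNIV - {i}. d j)) = of_int c *s z"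
  proof -
    have "of_int c * z $ i = (of_int (m i * (\<Prod>j\<in>UNIV - {i}. d j)) :: rat)" for i
    proof -
      have "c = d i * (\<Prod>j\<in>UNIV - {i}. d j)"
        unfolding c_def by (rule prod.remove) auto
      then have "of_int c = (of_int (d i) * of_int (\<Prod>j\<in>UNIV - {i}. d j) :: rat)"
        by (metis of_int_mult)
      then show ?thesis
        using d[of i] by (simp add: z)
    qed
    then show ?thesis
      by (simp add: vec_eq_iff)
  qed
  ultimately show ?thesis by blast
qed

text \<open>A singular integer matrix has a rational left null vector; multiplying it by a common
  denominator makes it integral.\<close>

lemma int_left_kernel:
  fixes D :: "int ^ 'k ^ 'k"
  assumes "det D = 0"
  shows "\<exists>u. u \<noteq> 0 \<and> u v* D = 0"
proof -
  let ?D = "of_int_matrix D :: rat ^ 'k ^ 'k"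
  have "\<not> invertible (transpose ?D)"
    using assms by (simp add: invertible_det_nz det_transpose det_of_int_matrix)
  then obtain z where z: "z \<noteq> 0" "transpose ?D *v z = 0"
    by (metis invertible_left_inverse matrix_left_invertible_ker)
  obtain c u where c: "c \<noteq> 0" and u: "of_int_vec u = of_int c *s z"
    using clear_denominators[of z] by blast
  have "u \<noteq> 0"
  proof
    assume "u = 0"
    with u have "of_int c *s z = 0"
      by (simp add: vec_eq_iff)
    with c z(1) show False
      by simp
  qed
  moreover have "u v* D = 0"
  proof -
    have "of_int_vec (u v* D) = of_int_vec u v* ?D"
      by (simp add: vec_eq_iff vector_matrix_mult_def)
    also have "\<dots> = 0"
      using z(2) by (simp add: u vector_scalar_commute scalar_vector_matrix_assoc)
    finally show ?thesis
      by (simp add: vec_eq_iff)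
  qed
  ultimately show ?thesis by blast
qed

text \<open>The complex eigenvector only serves to show that the determinant of \<open>A^l - 1\<close> vanishes. As
  this determinant is an integer, it can be read over the rationals, which is what makes the
  fixed row vector integral and hence usable as the frequency of a character.\<close>

lemma fixed_row_vector_exists:
  fixes A :: "int ^ 'k ^ 'k"
  assumes "eigenvalue (of_int_matrix A) (lam::complex)" and "lam ^ l = 1"
  shows "\<exists>u. u \<noteq> 0 \<and> u v* matrix_power A l = u"
proof -
  obtain v where v: "v \<noteq> 0" "of_int_matrix A *v v = lam *s v"
    using assms(1) by (auto simp: eigenvalue_def)
  let ?D = "matrix_power A l - mat 1"
  have D: "(of_int_matrix ?D :: complex ^ 'k ^ 'k) = matrix_power (of_int_matrix A) l - mat 1"
    by (simp add: of_int_matrix_power[symmetric] vec_eq_iff mat_def)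
  have "(of_int_matrix ?D :: complex ^ 'k ^ 'k) *v v = 0"
    unfolding D using matrix_power_eigenvector[OF v(2), of l] assms(2)
    by (simp add: matrix_vector_mult_diff_rdistrib)
  with v(1) have "\<not> invertible (of_int_matrix ?D :: complex ^ 'k ^ 'k)"
    by (metis invertible_left_inverse matrix_left_invertible_ker)
  then have "det ?D = 0"
    by (simp add: invertible_det_nz det_of_int_matrix)
  then obtain u where "u \<noteq> 0" "u v* ?D = 0"
    using int_left_kernel by blast
  then show ?thesis
    by (auto simp: vector_matrix_mult_diff_rdistrib vector_matrix_left_distrib)
qed

text \<open>The exponents can be reduced modulo \<open>l\<close>.\<close>

lemma finite_row_orbit:
  assumes "u v* matrix_power A l = u" and "l \<ge> 1"
  shows "finite (range (\<lambda>m. u v* matrix_power A m))"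
proof -
  have step: "u v* matrix_power A (l + m) = u v* matrix_power A m" for m
    by (simp add: matrix_power_add vector_matrix_mul_assoc[symmetric] assms(1))
  have "\<exists>r<l. u v* matrix_power A m = u v* matrix_power A r" for m
  proof (induction m rule: less_induct)
    case (less m)
    show ?case
    proof (cases "m < l")
      case False
      then show ?thesis
        using less[of "m - l"] step[of "m - l"] assms(2) by auto
    qed blast
  qed
  then have "range (\<lambda>m. u v* matrix_power A m) \<subseteq> (\<lambda>m. u v* matrix_power A m) ` {..<l}"
    by blast
  then show ?thesis
    by (rule finite_subset) simp
qed

section \<open>Characters of the group of vectors modulo p\<close>

definition int_dot :: "int ^ 'k \<Rightarrow> int ^ 'k \<Rightarrow> int" where
  "int_dot u x = (\<Sum>i\<in>UNIV. u $ i * x $ i)"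

definition vec_character :: "nat \<Rightarrow> int ^ 'k \<Rightarrow> int ^ 'k \<Rightarrow> complex" where
  "vec_character p u x = cis (2 * pi * (real_of_int (int_dot u x) / real p))"

lemma int_dot_add: "int_dot u (x + y) = int_dot u x + int_dot u y"
  by (simp add: int_dot_def distrib_left sum.distrib)

lemma int_dot_matrix: "int_dot u (A *v x) = int_dot (u v* A) x"
proof -
  have "int_dot u (A *v x) = (\<Sum>i\<in>UNIV. \<Sum>j\<in>UNIV. u $ i * A $ i $ j * x $ j)"
    by (simp add: int_dot_def matrix_vector_mult_def sum_distrib_left mult.assoc)
  also have "\<dots> = (\<Sum>j\<in>UNIV. \<Sum>i\<in>UNIV. u $ i * A $ i $ j * x $ j)"
    by (rule sum.swap)
  finally show ?thesis
    by (simp add: int_dot_def vector_matrix_mult_def sum_distrib_right)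
qed

lemma norm_vec_character [simp]: "norm (vec_character p u x) = 1"
  by (simp add: vec_character_def)

lemma vec_character_add:
  "vec_character p u (x + y) = vec_character p u x * vec_character p u y"
  by (simp add: vec_character_def int_dot_add cis_mult add_divide_distrib distrib_left)

lemma vec_character_matrix: "vec_character p u (A *v x) = vec_character p (u v* A) x"
  by (simp add: vec_character_def int_dot_matrix)

text \<open>Integrality of \<open>u\<close> makes the character well defined on residues.\<close>

lemma vec_character_mod_vec:
  assumes "p > 0"
  shows "vec_character p u (mod_vec p x) = vec_character p u x"
proof -
  define q :: "int ^ 'a" where "q = (\<chi> i. x $ i div int p)"
  have "x = mod_vec p x + int p *s q"
    by (simp add: vec_eq_iff mod_vec_def q_def mod_mult_div_eq)
  moreover have "int_dot u (int p *s q) = int p * int_dot u q"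
    by (simp add: int_dot_def sum_distrib_left algebra_simps)
  then have "vec_character p u (int p *s q) = 1"
    using assms by (simp add: vec_character_def)
  ultimately show ?thesis
    by (metis vec_character_add mult.right_neutral)
qed

text \<open>The value is \<open>exp (2\<pi>i u\<^sub>i / p)\<close>, so the character is trivial only if \<open>p\<close> divides all the
  entries of \<open>u\<close>.\<close>

lemma vec_character_axis_neq_1:
  assumes p: "p > 0" and u: "\<not> int p dvd u $ i"
  shows "vec_character p u (axis i 1) \<noteq> 1"
proof
  assume eq: "vec_character p u (axis i 1) = 1"
  have "int_dot u (axis i 1) = u $ i"
    by (simp add: int_dot_def axis_def if_distrib cong: if_cong)
  with eq have "cos (2 * pi * (real_of_int (u $ i) / real p)) = 1"
    by (metis vec_character_def cis.sel(1) one_complex.sel(1))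
  then obtain m :: int where "2 * pi * (real_of_int (u $ i) / real p) = m * 2 * pi"
    by (auto simp: cos_one_2pi_int)
  then have "real_of_int (u $ i) = real_of_int (m * int p)"
    using p by (simp add: field_simps)
  then have "u $ i = m * int p"
    by (simp only: of_int_eq_iff)
  with u show False
    by simp
qed

lemma mod_vec_in_Zp_vectors: "p > 0 \<Longrightarrow> mod_vec p x \<in> Zp_vectors p"
  by (simp add: mod_vec_def Zp_vectors_def)

lemma mod_vec_Zp_vectors: "x \<in> Zp_vectors p \<Longrightarrow> mod_vec p x = x"
  by (simp add: mod_vec_def Zp_vectors_def vec_eq_iff)

lemma mod_vec_add_mod_vec: "mod_vec p (mod_vec p x + y) = mod_vec p (x + y)"
  by (simp add: mod_vec_def vec_eq_iff mod_add_left_eq)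

text \<open>Orthogonality with the trivial character: translating the summation variable by the unit
  vector \<open>e\<^sub>i\<close> multiplies the sum by \<open>\<chi>\<^sub>u(e\<^sub>i) \<noteq> 1\<close>.\<close>

lemma sum_vec_character_eq_0:
  fixes u :: "int ^ 'k"
  assumes p: "p > 0" and u: "\<not> int p dvd u $ i"
  shows "(\<Sum>x\<in>Zp_vectors p. vec_character p u x) = 0"
proof -
  let ?e = "axis i 1 :: int ^ 'k"
  let ?Z = "Zp_vectors p :: (int ^ 'k) set"
  have bij: "bij_betw (\<lambda>x. mod_vec p (x + ?e)) ?Z ?Z"
  proof (rule bij_betw_byWitness[where f' = "\<lambda>x. mod_vec p (x + (- ?e))"])
    show "\<forall>x\<in>?Z. mod_vec p (mod_vec p (x + ?e) + (- ?e)) = x"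
      and "\<forall>x\<in>?Z. mod_vec p (mod_vec p (x + (- ?e)) + ?e) = x"
      unfolding mod_vec_add_mod_vec by (simp_all add: mod_vec_Zp_vectors)
  qed (auto intro: mod_vec_in_Zp_vectors p)
  have "(\<Sum>x\<in>?Z. vec_character p u x) = (\<Sum>x\<in>?Z. vec_character p u (mod_vec p (x + ?e)))"
    by (rule sum.reindex_bij_betw[OF bij, symmetric])
  also have "\<dots> = (\<Sum>x\<in>?Z. vec_character p u x) * vec_character p u ?e"
    by (simp add: vec_character_mod_vec p vec_character_add sum_distrib_right)
  finally show ?thesis
    using vec_character_axis_neq_1[of p u i] p u by (simp add: mult_cancel_left1)
qed

text \<open>The expectation of the character does not change if the uniform distribution is subtracted
  from the law of \<open>X\<close>, and the character has modulus one.\<close>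

lemma variation_distance_ge_character:
  fixes X :: "'w \<Rightarrow> int ^ 'k"
  assumes "prob_space M" and X: "X \<in> measurable M (count_space UNIV)"
    and Z: "\<And>\<omega>. X \<omega> \<in> Zp_vectors p" and p: "p > 0" and u: "\<not> int p dvd u $ i"
  shows "norm (\<integral>\<omega>. vec_character p u (X \<omega>) \<partial>M) / 2 \<le>
           variation_distance_uniform p (distr M (count_space UNIV) X)"
proof -
  interpret prob_space M by fact
  let ?Z = "Zp_vectors p :: (int ^ 'k) set"
  let ?P = "distr M (count_space UNIV) X"
  let ?U = "pmf (pmf_of_set ?Z)"
  have meas: "X -` {x} \<inter> space M \<in> sets M" for x
    using X by (rule measurable_sets) simp
  have "(\<integral>\<omega>. vec_character p u (X \<omega>) \<partial>M) =
        (\<integral>\<omega>. (\<Sum>x\<in>?Z. indicator (X -` {x} \<inter> space M) \<omega> *\<^sub>R vec_character p u x) \<partial>M)"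
  proof (rule Bochner_Integration.integral_cong[OF refl])
    fix \<omega> assume "\<omega> \<in> space M"
    then have "(\<Sum>x\<in>?Z. indicator (X -` {x} \<inter> space M) \<omega> *\<^sub>R vec_character p u x) =
               (\<Sum>x\<in>?Z. if X \<omega> = x then vec_character p u x else 0)"
      by (intro sum.cong) (auto simp: indicator_def)
    then show "vec_character p u (X \<omega>) =
               (\<Sum>x\<in>?Z. indicator (X -` {x} \<inter> space M) \<omega> *\<^sub>R vec_character p u x)"
      using Z by (simp add: finite_Zp_vectors)
  qed
  also have "\<dots> = (\<Sum>x\<in>?Z. measure M (X -` {x} \<inter> space M) *\<^sub>R vec_character p u x)"
  proof -
    have "integrable M (indicat_real (X -` {x} \<inter> space M))" for x
      using meas by (simp add: integrable_indicator_iff emeasure_eq_measure)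
    then show ?thesis
      by (simp add: Int_absorb2)
  qed
  also have "\<dots> = (\<Sum>x\<in>?Z. measure ?P {x} *\<^sub>R vec_character p u x)"
    using X by (simp add: measure_distr)
  also have "\<dots> = (\<Sum>x\<in>?Z. (measure ?P {x} - ?U x) *\<^sub>R vec_character p u x)"
  proof -
    have "0 \<in> ?Z"
      using p by (simp add: Zp_vectors_def)
    then have "(\<Sum>x\<in>?Z. ?U x *\<^sub>R vec_character p u x) =
               (1 / card ?Z) *\<^sub>R (\<Sum>x\<in>?Z. vec_character p u x)"
      by (subst scaleR_sum_right) (intro sum.cong refl, subst pmf_of_set,
        auto simp: finite_Zp_vectors)
    then show ?thesis
      using sum_vec_character_eq_0[of p u i] p u by (simp add: scaleR_left_diff_distrib sum_subtractf)
  qed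
  finally have "norm (\<integral>\<omega>. vec_character p u (X \<omega>) \<partial>M) \<le>
      (\<Sum>x\<in>?Z. norm ((measure ?P {x} - ?U x) *\<^sub>R vec_character p u x))"
    by (simp only: norm_sum)
  then show ?thesis
    by (simp add: variation_distance_uniform_def)
qed

section \<open>The characteristic function of the increments near the origin\<close>

lemma cos_ge_one_minus_square: "cos x \<ge> 1 - x\<^sup>2 / 2" for x :: real
proof -
  have "(sin (x / 2))\<^sup>2 \<le> (x / 2)\<^sup>2"
    using abs_sin_x_le_abs_x[of "x / 2"] by (simp only: abs_le_square_iff)
  then show ?thesis
    using cos_double_sin[of "x / 2"] by (simp add: power2_eq_square)
qed

lemma exp_le_one_minus: "exp (- (2 * x)) \<le> 1 - x" if "0 \<le> x" "x \<le> 1 / 2" for x :: real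
proof -
  have "1 \<le> (1 - x) * (1 + 2 * x)"
    using mult_nonneg_nonneg[of x "1 - 2 * x"] that by (simp add: algebra_simps)
  also have "\<dots> \<le> (1 - x) * exp (2 * x)"
    using that exp_ge_add_one_self[of "2 * x"] by (intro mult_left_mono) auto
  finally show ?thesis
    by (simp add: exp_minus field_simps)
qed

lemma int_dot_square_le:
  fixes u x :: "int ^ 'k"
  assumes "\<And>i. \<bar>u $ i\<bar> \<le> K"
  shows "(real_of_int (int_dot u x))\<^sup>2 \<le>
           (CARD('k) * of_int K)\<^sup>2 * (infnorm (of_int_vec x :: real ^ 'k))\<^sup>2"
proof -
  let ?m = "infnorm (of_int_vec x :: real ^ 'k)"
  have "\<bar>real_of_int (int_dot u x)\<bar> \<le> (\<Sum>i\<in>UNIV. \<bar>real_of_int (u $ i * x $ i)\<bar>)"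
    unfolding int_dot_def of_int_sum by (rule sum_abs)
  also have "\<dots> \<le> (\<Sum>i\<in>(UNIV::'k set). of_int K * ?m)"
  proof (rule sum_mono)
    fix i
    have "\<bar>real_of_int (u $ i)\<bar> \<le> of_int K"
      using assms[of i] by linarith
    moreover have "\<bar>real_of_int (x $ i)\<bar> \<le> ?m"
      using component_le_infnorm_cart[of "of_int_vec x :: real ^ 'k" i] by simp
    ultimately show "\<bar>real_of_int (u $ i * x $ i)\<bar> \<le> of_int K * ?m"
      unfolding of_int_mult abs_mult by (intro mult_mono) auto
  qed
  finally have "\<bar>real_of_int (int_dot u x)\<bar> \<le> CARD('k) * of_int K * ?m"
    by simp
  then have "\<bar>real_of_int (int_dot u x)\<bar>\<^sup>2 \<le> (CARD('k) * of_int K * ?m)\<^sup>2"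
    by (rule power_mono) simp
  then show ?thesis
    by (simp add: power_mult_distrib)
qed

text \<open>The modulus is at least the real part, which is the expectation of a cosine. Bounding the
  cosine to second order has no first moment term, so the mean of \<open>\<mu>\<close> does not have to be
  subtracted.\<close>

lemma norm_character_expectation_ge:
  fixes \<mu> :: "(int ^ 'k) pmf"
  assumes L2: "integrable (measure_pmf \<mu>) (\<lambda>x. (infnorm (of_int_vec x :: real ^ 'k))\<^sup>2)"
    and u: "\<And>i. \<bar>u $ i\<bar> \<le> K"
  shows "norm (\<integral>x. vec_character p u x \<partial>measure_pmf \<mu>) \<ge>
           1 - 2 * pi\<^sup>2 * (CARD('k) * of_int K)\<^sup>2 *
               (\<integral>x. (infnorm (of_int_vec x :: real ^ 'k))\<^sup>2 \<partial>measure_pmf \<mu>) / (real p)\<^sup>2"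
    (is "_ \<ge> 1 - ?c * integral\<^sup>L _ ?g / _")
proof -
  have int: "integrable (measure_pmf \<mu>) (vec_character p u)"
    by (rule measure_pmf.integrable_const_bound[where B = 1]) auto
  have pointwise: "1 - ?c / (real p)\<^sup>2 * ?g x \<le> Re (vec_character p u x)" for x
  proof -
    let ?t = "2 * pi * (real_of_int (int_dot u x) / real p)"
    have "?t\<^sup>2 / 2 = 2 * pi\<^sup>2 / (real p)\<^sup>2 * (real_of_int (int_dot u x))\<^sup>2"
      by (simp add: power_mult_distrib power_divide)
    also have "\<dots> \<le> 2 * pi\<^sup>2 / (real p)\<^sup>2 * ((CARD('k) * of_int K)\<^sup>2 * ?g x)"
      by (intro mult_left_mono int_dot_square_le u) auto
    also have "\<dots> = ?c / (real p)\<^sup>2 * ?g x"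
      by simp
    finally show ?thesis
      using cos_ge_one_minus_square[of ?t] by (simp add: vec_character_def)
  qed
  have "1 - ?c * integral\<^sup>L (measure_pmf \<mu>) ?g / (real p)\<^sup>2 =
        (\<integral>x. 1 - ?c / (real p)\<^sup>2 * ?g x \<partial>measure_pmf \<mu>)"
    by (subst Bochner_Integration.integral_diff)
      (use L2 in \<open>auto intro!: integrable_mult_right\<close>)
  also have "\<dots> \<le> (\<integral>x. Re (vec_character p u x) \<partial>measure_pmf \<mu>)"
    using L2 int by (intro integral_mono pointwise) auto
  also have "\<dots> = Re (\<integral>x. vec_character p u x \<partial>measure_pmf \<mu>)"
    using int by (rule integral_Re)
  also have "\<dots> \<le> norm (\<integral>x. vec_character p u x \<partial>measure_pmf \<mu>)"
    by (rule complex_Re_le_cmod)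
  finally show ?thesis .
qed

section \<open>Characters along the recursion\<close>

lemma affine_recursion_in_Zp:
  assumes "p > 0"
  shows "affine_recursion p A \<B> x0 n \<omega> \<in> Zp_vectors p"
  using assms by (cases n) (simp_all add: mod_vec_in_Zp_vectors)

lemma measurable_affine_recursion:
  assumes "\<And>n. \<B> n \<in> measurable M (count_space UNIV)"
  shows "affine_recursion p A \<B> x0 n \<in> measurable M (count_space UNIV)"
proof (induction n)
  case (Suc n)
  have "(\<lambda>\<omega>. (affine_recursion p A \<B> x0 n \<omega>, \<B> n \<omega>)) \<in> measurable M (count_space UNIV)"
    using measurable_Pair[OF Suc assms[of n]] by (simp add: pair_measure_countable)
  then have "(\<lambda>\<omega>. (\<lambda>(x, b). mod_vec p (A *v x + b)) (affine_recursion p A \<B> x0 n \<omega>, \<B> n \<omega>))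
      \<in> measurable M (count_space UNIV)"
    by (rule measurable_compose) simp
  then show ?case
    by simp
qed simp

text \<open>The adjoint action \<open>u \<mapsto> uA\<close> on frequencies replaces the action of \<open>A\<close> on the state.
  Peeling off the last step changes the frequency of all the earlier ones, hence the induction
  over \<open>n\<close> for arbitrary \<open>u\<close>.\<close>

lemma vec_character_affine_recursion:
  assumes "p > 0"
  shows "vec_character p u (affine_recursion p A \<B> x0 n \<omega>) =
           vec_character p (u v* matrix_power A n) x0 *
           (\<Prod>j<n. vec_character p (u v* matrix_power A (n - Suc j)) (\<B> j \<omega>))"
proof (induction n arbitrary: u)
  case 0
  then show ?case
    using assms by (simp add: matrix_power_0 vec_character_mod_vec)
next
  case (Suc n)
  have shift: "u v* A v* matrix_power A m = u v* matrix_power A (Suc m)" for m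
    by (simp add: matrix_power_Suc vector_matrix_mul_assoc)
  have "vec_character p u (affine_recursion p A \<B> x0 (Suc n) \<omega>) =
        vec_character p (u v* A) (affine_recursion p A \<B> x0 n \<omega>) * vec_character p u (\<B> n \<omega>)"
    using assms by (simp add: vec_character_mod_vec vec_character_add vec_character_matrix)
  also have "\<dots> = vec_character p (u v* matrix_power A (Suc n)) x0 *
      ((\<Prod>j<n. vec_character p (u v* matrix_power A (Suc (n - Suc j))) (\<B> j \<omega>)) *
       vec_character p u (\<B> n \<omega>))"
    by (simp add: Suc.IH shift)
  also have "(\<Prod>j<n. vec_character p (u v* matrix_power A (Suc (n - Suc j))) (\<B> j \<omega>)) =
             (\<Prod>j<n. vec_character p (u v* matrix_power A (Suc n - Suc j)) (\<B> j \<omega>))"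
    by (intro prod.cong) (auto simp: Suc_diff_Suc)
  finally show ?case
    by (simp add: matrix_power_0)
qed

text \<open>The factors of the product formula are functions of different increments, so the
  expectation is a product too; reversing the order of the factors removes \<open>n\<close> from the
  exponents.\<close>

lemma (in prob_space) norm_expectation_character_affine_recursion:
  assumes p: "p > 0"
    and indep: "indep_vars (\<lambda>_. count_space UNIV) \<B> UNIV"
    and law: "\<And>n. distr M (count_space UNIV) (\<B> n) = measure_pmf \<mu>"
  shows "norm (expectation (\<lambda>\<omega>. vec_character p u (affine_recursion p A \<B> x0 n \<omega>))) =
           (\<Prod>m<n. norm (\<integral>x. vec_character p (u v* matrix_power A m) x \<partial>measure_pmf \<mu>))"
proof -
  have meas: "\<B> j \<in> measurable M (count_space UNIV)" for j
    using indep by (auto simp: indep_vars_def)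
  let ?f = "\<lambda>j. vec_character p (u v* matrix_power A (n - Suc j))"
  have ind: "indep_vars (\<lambda>_. borel) (\<lambda>j \<omega>. ?f j (\<B> j \<omega>)) {..<n}"
    by (rule indep_vars_compose2[OF indep_vars_subset[OF indep]]) auto
  have int: "integrable M (\<lambda>\<omega>. ?f j (\<B> j \<omega>))" for j
    using measurable_compose[OF meas[of j], of "?f j" borel]
    by (intro integrable_const_bound[where B = 1]) auto
  have "norm (expectation (\<lambda>\<omega>. vec_character p u (affine_recursion p A \<B> x0 n \<omega>))) =
        norm (expectation (\<lambda>\<omega>. \<Prod>j<n. ?f j (\<B> j \<omega>)))"
    by (simp add: vec_character_affine_recursion[OF p] norm_mult)
  also have "\<dots> = (\<Prod>j<n. norm (expectation (\<lambda>\<omega>. ?f j (\<B> j \<omega>))))"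
    by (subst indep_vars_lebesgue_integral[OF _ ind]) (simp_all add: int prod_norm)
  also have "\<dots> = (\<Prod>j<n. norm (\<integral>x. ?f j x \<partial>measure_pmf \<mu>))"
  proof -
    have "(\<integral>x. ?f j x \<partial>measure_pmf \<mu>) = expectation (\<lambda>\<omega>. ?f j (\<B> j \<omega>))" for j
      unfolding law[of j, symmetric] by (rule integral_distr[OF meas]) simp
    then show ?thesis
      by simp
  qed
  also have "\<dots> = (\<Prod>m<n. norm (\<integral>x. vec_character p (u v* matrix_power A m) x \<partial>measure_pmf \<mu>))"
    by (rule prod.nat_diff_reindex)
  finally show ?thesis .
qed

theorem theorem3p11:
  fixes A Bm :: "int ^ 'k ^ 'k"
    and lam :: complex
    and l :: nat
    and \<mu> :: "(int ^ 'k) pmf"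
    and M :: "'w measure"
    and \<B> :: "nat \<Rightarrow> 'w \<Rightarrow> int ^ 'k"
    and x0 :: "int ^ 'k"
  assumes A_invertible: "invertible (of_int_matrix A :: rat ^ 'k ^ 'k)"
    and eigenvalue: "eigenvalue (of_int_matrix A) lam"
    and root_of_unity: "l \<ge> 1" "lam ^ l = 1"
    and support: "\<not> (\<exists>W. invariant_subspace (of_int_matrix A) W \<and> W \<noteq> UNIV \<and>
                          parallel_to (set_pmf \<mu>) W)"
    and prob_space: "prob_space M"
    and indep: "prob_space.indep_vars M (\<lambda>_. count_space UNIV) \<B> UNIV"
    and common_law: "\<And>n. distr M (count_space UNIV) (\<B> n) = measure_pmf \<mu>"
    and L2: "\<And>n. integrable M (\<lambda>\<omega>. (infnorm (of_int_vec (\<B> n \<omega>) :: real ^ 'k))\<^sup>2)"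
    and columns_basis: "columns_form_rat_basis Bm"
    and columns_in: "columns Bm \<subseteq> shifted_differences A \<mu>"
  shows "\<exists>\<gamma>>0. \<exists>N::nat. \<forall>p::nat. p > N \<and> gcd (det A) (int p) = 1 \<and> gcd (det Bm) (int p) = 1 \<longrightarrow>
           (\<forall>n::nat. variation_distance_uniform p
                        (distr M (count_space UNIV) (affine_recursion p A \<B> x0 n))
                      \<ge> 1 / 2 * exp (- (\<gamma> * real n / (real p)\<^sup>2)))"
proof -
  interpret prob_space M by (fact prob_space)
  obtain u where u: "u \<noteq> 0" "u v* matrix_power A l = u"
    using fixed_row_vector_exists[OF eigenvalue root_of_unity(2)] by blast
  define row where "row m = u v* matrix_power A m" for m
  have "finite ((\<lambda>(v, i). \<bar>v $ i\<bar>) ` (range row \<times> UNIV))"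
    using finite_row_orbit[OF u(2) root_of_unity(1)] by (simp add: row_def)
  then obtain K where K: "\<bar>row m $ i\<bar> \<le> K" for m i
    by (fastforce dest: bdd_above_finite simp: bdd_above_def)
  have row_0: "row 0 = u"
    by (simp add: row_def matrix_power_0)
  have meas: "\<B> n \<in> measurable M (count_space UNIV)" for n
    using indep by (auto simp: indep_vars_def)
  let ?g = "\<lambda>x. (infnorm (of_int_vec x :: real ^ 'k))\<^sup>2"
  have L2_\<mu>: "integrable (measure_pmf \<mu>) ?g"
    using L2[of 0] meas[of 0] unfolding common_law[of 0, symmetric]
    by (subst integrable_distr_eq) auto
  define C where "C = 2 * pi\<^sup>2 * (CARD('k) * of_int K)\<^sup>2 * integral\<^sup>L (measure_pmf \<mu>) ?g"
  have C: "C \<ge> 0"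
    by (auto simp: C_def intro!: mult_nonneg_nonneg integral_nonneg)
  \<comment> \<open>Above \<open>K\<close>, the modulus cannot divide a nonzero entry of \<open>u\<close>; above \<open>2 * C\<close>, the quotient
    \<open>C / p\<^sup>2\<close> is at most \<open>1/2\<close>.\<close>
  define N where "N = nat \<lceil>max (real_of_int K) (2 * C)\<rceil>"
  \<comment> \<open>With the summand 1, positivity of \<open>\<gamma>\<close> follows from \<open>C \<ge> 0\<close>.\<close>
  show ?thesis
  proof (intro exI[of _ "2 * C + 1"] exI[of _ N] conjI allI impI)
    show "2 * C + 1 > 0"
      using C by simp
  next
    fix p n :: nat
    assume "p > N \<and> gcd (det A) (int p) = 1 \<and> gcd (det Bm) (int p) = 1"
    then have "p > N" by blast
    then have "real p > max (real_of_int K) (2 * C)" and p: "p > 0"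
      by (auto simp: N_def) linarith+
    then have pK: "int p > K" and pC: "2 * C \<le> real p"
      by linarith+
    have "real p \<le> (real p)\<^sup>2"
      using p by (simp add: power2_eq_square)
    with pC have "2 * C \<le> (real p)\<^sup>2"
      by (rule order_trans)
    then have small: "C / (real p)\<^sup>2 \<le> 1 / 2"
      using p by (simp add: field_simps)
    obtain i where "u $ i \<noteq> 0"
      using u(1) by (auto simp: vec_eq_iff)
    then have not_dvd: "\<not> int p dvd u $ i"
      using K[of 0 i] pK by (auto simp: row_0 dest: dvd_imp_le_int)
    let ?\<phi> = "\<lambda>m. norm (\<integral>x. vec_character p (row m) x \<partial>measure_pmf \<mu>)"
    have factor: "exp (- (2 * (C / (real p)\<^sup>2))) \<le> ?\<phi> m" for m
    proof -
      have "exp (- (2 * (C / (real p)\<^sup>2))) \<le> 1 - C / (real p)\<^sup>2"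
        using C small by (intro exp_le_one_minus) auto
      also have "\<dots> \<le> ?\<phi> m"
        unfolding C_def by (intro norm_character_expectation_ge L2_\<mu> K)
      finally show ?thesis .
    qed
    have "1 / 2 * exp (- ((2 * C + 1) * real n / (real p)\<^sup>2)) \<le>
          1 / 2 * exp (- (2 * (C / (real p)\<^sup>2))) ^ n"
      using C by (simp add: exp_of_nat_mult[symmetric] field_simps divide_right_mono)
    also have "\<dots> \<le> 1 / 2 * (\<Prod>m<n. ?\<phi> m)"
      using prod_mono[of "{..<n}" "\<lambda>_. exp (- (2 * (C / (real p)\<^sup>2)))" ?\<phi>] factor by simp
    also have "\<dots> = norm (expectation (\<lambda>\<omega>. vec_character p u (affine_recursion p A \<B> x0 n \<omega>))) / 2"
      by (simp add: norm_expectation_character_affine_recursion[OF p indep common_law] row_def)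
    also have "\<dots> \<le> variation_distance_uniform p
                      (distr M (count_space UNIV) (affine_recursion p A \<B> x0 n))"
      by (rule variation_distance_ge_character[OF prob_space_axioms
            measurable_affine_recursion[OF meas] affine_recursion_in_Zp[OF p] p not_dvd])
    finally show "1 / 2 * exp (- ((2 * C + 1) * real n / (real p)\<^sup>2)) \<le>
        variation_distance_uniform p (distr M (count_space UNIV) (affine_recursion p A \<B> x0 n))" .
  qed
qed

end
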